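(* Let $\mathcal H_A,\mathcal H_B,\mathcal H_E$, the unitaries $U$ on $\mathcal H_A\otimes\mathcal H_E$ and $V$ on $\mathcal H_B\otimes\mathcal H_E$, the unit vectors $|\chi\rangle_E,|\tilde\chi\rangle_E\in\mathcal H_E$, the state $|\psi\rangle_{AB}$, and the maps $\mathcal W$ and $\mathcal Q$ be as in the context. Let $\{|j\rangle_E:j=0,\dots,D_E-1\}\subset\mathcal H_E$ be an overcomplete system, i.e. a family (not necessarily orthonormal or linearly independent) with $\sum_j|j\rangle_E\langle j|=I_E$, and define $$f_j=\langle j|_E\,U\,|\chi\rangle_E\in\mathcal O(\mathcal H_A),\qquad g_j=\langle j|_E\,V^\dagger\,|\tilde\chi\rangle_E\in\mathcal O(\mathcal H_B).$$ Then the special reversal condition $$(I_A\otimes V)(U\otimes I_B)\,|\psi\rangle_{AB}\otimes|\chi\rangle_E=|\psi\rangle_{AB}\otimes|\tilde\chi\rangle_E$$ is satisfied if and only if $$g_j=\mathcal W\mathcal Q f_j\quad\text{for all } j.$$ Moreover, if this relation holds for the operators $\{f_j\},\{g_j\}$ defined with respect to one overcomplete system $\{|j\rangle_E\}$ of $\mathcal H_E$, then it holds for the operators defined in the same way with respect to any overcomplete system of $\mathcal H_E$.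
   Context: All Hilbert spaces are complex and finite-dimensional; $\mathcal O(\mathcal H)$ is the set of linear operators on $\mathcal H$; a map is an operator acting on operators. $I_{x\dots}$ is the identity on $\mathcal H_x\otimes\cdots$, and $\operatorname{tr}_x$ is the partial trace over $\mathcal H_x$. In products such as $(I_A\otimes V)(U\otimes I_B)$ all operators act on $\mathcal H_A\otimes\mathcal H_B\otimes\mathcal H_E$, each operator acting on the tensor factors it is defined on and as the identity on the others. Setting: $\mathcal H_A,\mathcal H_B,\mathcal H_E$ are Hilbert spaces with $\dim\mathcal H_A=\dim\mathcal H_B=d$. $U$ is a unitary on $\mathcal H_A\otimes\mathcal H_E$, $V$ is a unitary on $\mathcal H_B\otimes\mathcal H_E$, and $|\chi\rangle_E,|\tilde\chi\rangle_E$ are unit vectors in $\mathcal H_E$. The CPTP map $\mathcal F$ on $\mathcal O(\mathcal H_A)$ is $\mathcal F\rho_A=\operatorname{tr}_E[U(\rho_A\otimes|\chi\rangle_E\langle\chi|)U^\dagger]$, and $\sigma\in\mathcal O(\mathcal H_A)$ is a density operator with $\mathcal F\sigma=\sigma$ and spectral form $\sigma=\sum_{n=0}^{d-1}p_n|n\rangle_A\langle n|$, where $\{|n\rangle_A\}$ is an orthonormal basis of $\mathcal H_A$ and $p_n>0$ for all $n$. $\theta$ is a conjugation on $\mathcal H_A$ (antilinear, $\langle\theta\phi,\theta\psi\rangle=\langle\psi,\phi\rangle$ for all $\phi,\psi$, and $\theta^2=I_A$) and $W:\mathcal H_A\to\mathcal H_B$ is unitary. Put $|\tilde n\rangle_B=W\theta|n\rangle_A$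 and $|\psi\rangle_{AB}=\sum_n\sqrt{p_n}\,|n\rangle_A\otimes|\tilde n\rangle_B$. Partial kets and bras: for $\xi\in\mathcal H_E$ and $x=A$ or $B$, $|\xi\rangle_E:\mathcal H_x\to\mathcal H_x\otimes\mathcal H_E$ is the operator $\phi\mapsto\phi\otimes\xi$, and $\langle\xi|_E:\mathcal H_x\otimes\mathcal H_E\to\mathcal H_x$ is its adjoint. Maps: $\mathcal WX=WXW^\dagger$ from $\mathcal O(\mathcal H_A)$ to $\mathcal O(\mathcal H_B)$; on $\mathcal O(\mathcal H_A)$, $\Theta X=\theta X\theta$, $\mathcal JX=X^\dagger$, $\Delta_\sigma^{-1/2}X=\sigma^{-1/2}X\sigma^{1/2}$, and $\mathcal Q=\Theta\,\mathcal J\,\Delta_\sigma^{-1/2}$ (a linear map). *)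

theory Defs
  imports "HOL-Analysis.Analysis"
begin

text \<open>
  An \<open>n\<close>-dimensional Hilbert space is the coordinate space \<^typ>\<open>complex^'n\<close> with the Hermitian
  inner product \<open>cinner\<close> below; its norm is the library norm. (The library's \<open>inner\<close> on this type
  is only the real part of \<open>cinner\<close>.) Operators are matrices, and a tensor product of
  spaces is the coordinate space over the product of the index types; the order of the factors
  is always \<open>A, B, E\<close>.
\<close>

definition cinner :: "complex^'n \<Rightarrow> complex^'n \<Rightarrow> complex" where
  "cinner x y = (\<Sum>i\<in>UNIV. cnj (x $ i) * y $ i)"

definition adj :: "complex^'n^'m \<Rightarrow> complex^'m^'n" where
  "adj M = (\<chi> i j. cnj (M $ j $ i))"

definition unitary :: "complex^'n^'m \<Rightarrow> bool" where
  "unitary M \<longleftrightarrow> adj M ** M = mat 1 \<and> M ** adj M = mat 1"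

definition ketbra :: "complex^'m \<Rightarrow> complex^'n \<Rightarrow> complex^'n^'m" where
  "ketbra x y = (\<chi> i j. x $ i * cnj (y $ j))"

definition density_operator :: "complex^'n^'n \<Rightarrow> bool" where
  "density_operator \<rho> \<longleftrightarrow> (\<forall>x. cinner x (\<rho> *v x) \<in> \<real>\<^sub>\<ge>\<^sub>0) \<and> trace \<rho> = 1"

definition orthonormal_basis :: "nat \<Rightarrow> (nat \<Rightarrow> complex^'n) \<Rightarrow> bool" where
  "orthonormal_basis d e \<longleftrightarrow>
     (\<forall>m<d. \<forall>n<d. cinner (e m) (e n) = (if m = n then 1 else 0)) \<and>
     vec.span (e ` {..<d}) = UNIV"

definition overcomplete :: "nat \<Rightarrow> (nat \<Rightarrow> complex^'n) \<Rightarrow> bool" where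
  "overcomplete D k \<longleftrightarrow> (\<Sum>j<D. ketbra (k j) (k j)) = mat 1"

definition conjugation :: "(complex^'n \<Rightarrow> complex^'n) \<Rightarrow> bool" where
  "conjugation \<theta> \<longleftrightarrow>
     (\<forall>\<phi> \<psi>. \<theta> (\<phi> + \<psi>) = \<theta> \<phi> + \<theta> \<psi>) \<and> (\<forall>c \<phi>. \<theta> (c *s \<phi>) = cnj c *s \<theta> \<phi>) \<and>
     (\<forall>\<phi> \<psi>. cinner (\<theta> \<phi>) (\<theta> \<psi>) = cinner \<psi> \<phi>) \<and> (\<forall>\<phi>. \<theta> (\<theta> \<phi>) = \<phi>)"

definition tensor_vec :: "complex^('m::finite) \<Rightarrow> complex^('n::finite) \<Rightarrow> complex^('m \<times> 'n)" where
  "tensor_vec x y = (\<chi> i. x $ fst i * y $ snd i)"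

definition tensor_op ::
    "complex^('m::finite)^'m \<Rightarrow> complex^('n::finite)^'n \<Rightarrow> complex^('m \<times> 'n)^('m \<times> 'n)" where
  "tensor_op M N = (\<chi> i j. M $ fst i $ fst j * N $ snd i $ snd j)"

definition ptrace_E :: "complex^('x::finite \<times> 'e::finite)^('x \<times> 'e) \<Rightarrow> complex^'x^'x" where
  "ptrace_E M = (\<chi> i j. \<Sum>e\<in>UNIV. M $ (i, e) $ (j, e))"

definition tensor_AB_E ::
    "complex^('a::finite \<times> 'b::finite) \<Rightarrow> complex^('e::finite) \<Rightarrow>
     complex^('a \<times> 'b \<times> 'e)" where
  "tensor_AB_E \<Psi> \<xi> = vec_lambda (\<lambda>(a, b, e). \<Psi> $ (a, b) * \<xi> $ e)"

definition lift_BE ::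
    "complex^('b::finite \<times> 'e::finite)^('b \<times> 'e) \<Rightarrow>
     complex^('a::finite \<times> 'b \<times> 'e)^('a \<times> 'b \<times> 'e)" where
  "lift_BE V = tensor_op (mat 1) V"

text \<open>\<open>U\<^sub>A\<^sub>E \<otimes> I\<^sub>B\<close>, acting on the non-adjacent factors \<open>A\<close> and \<open>E\<close> of \<open>A \<otimes> B \<otimes> E\<close>.\<close>

definition lift_AE ::
    "complex^('a::finite \<times> 'e::finite)^('a \<times> 'e) \<Rightarrow>
     complex^('a \<times> 'b::finite \<times> 'e)^('a \<times> 'b \<times> 'e)" where
  "lift_AE U = vec_lambda (\<lambda>(a, b, e).
     vec_lambda (\<lambda>(a', b', e'). if b = b' then U $ (a, e) $ (a', e') else 0))"

definition ket_E :: "complex^('e::finite) \<Rightarrow> complex^('x::finite)^('x \<times> 'e)" where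
  "ket_E \<xi> = matrix (\<lambda>\<phi>. tensor_vec \<phi> \<xi>)"

definition bra_E :: "complex^('e::finite) \<Rightarrow> complex^('x::finite \<times> 'e)^'x" where
  "bra_E \<xi> = adj (ket_E \<xi>)"

definition channel_F ::
    "complex^('a::finite \<times> 'e::finite)^('a \<times> 'e) \<Rightarrow> complex^'e \<Rightarrow> complex^'a^'a \<Rightarrow> complex^'a^'a" where
  "channel_F U \<xi> \<rho> = ptrace_E (U ** tensor_op \<rho> (ketbra \<xi> \<xi>) ** adj U)"

definition psi_AB ::
    "nat \<Rightarrow> (nat \<Rightarrow> real) \<Rightarrow> (nat \<Rightarrow> complex^('a::finite)) \<Rightarrow> (complex^'a \<Rightarrow> complex^'a) \<Rightarrow>
     complex^'a^('b::finite) \<Rightarrow> complex^('a \<times> 'b)" where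
  "psi_AB d p e \<theta> W = (\<Sum>n<d. sqrt (p n) *\<^sub>R tensor_vec (e n) (W *v \<theta> (e n)))"

text \<open>
  The real power \<open>\<sigma>\<^sup>s\<close> of the operator with spectral form \<open>\<sigma> = (\<Sum>n<d. p n *\<^sub>R ketbra (e n) (e n))\<close>,
  for \<open>p n > 0\<close> and \<open>e\<close> an orthonormal basis.
\<close>

definition spectral_powr ::
    "nat \<Rightarrow> (nat \<Rightarrow> real) \<Rightarrow> (nat \<Rightarrow> complex^'n) \<Rightarrow> real \<Rightarrow> complex^'n^'n" where
  "spectral_powr d p e s = (\<Sum>n<d. (p n powr s) *\<^sub>R ketbra (e n) (e n))"

definition map_W :: "complex^'a^'b \<Rightarrow> complex^'a^'a \<Rightarrow> complex^'b^'b" where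
  "map_W W X = W ** X ** adj W"

text \<open>
  For antilinear \<open>\<theta>\<close> the map \<open>\<phi> \<mapsto> \<theta> (X (\<theta> \<phi>))\<close> is linear, so \<open>matrix\<close> represents it faithfully.
\<close>

definition map_Theta :: "(complex^'a \<Rightarrow> complex^'a) \<Rightarrow> complex^'a^'a \<Rightarrow> complex^'a^'a" where
  "map_Theta \<theta> X = matrix (\<lambda>\<phi>. \<theta> (X *v \<theta> \<phi>))"

definition map_J :: "complex^'a^'a \<Rightarrow> complex^'a^'a" where
  "map_J X = adj X"

text \<open>\<open>\<Delta>\<^sub>\<sigma>\<close> to the power \<open>-1/2\<close>, with \<open>\<sigma>\<close> given by its spectral data.\<close>

definition map_Delta_mhalf ::
    "nat \<Rightarrow> (nat \<Rightarrow> real) \<Rightarrow> (nat \<Rightarrow> complex^'a) \<Rightarrow> complex^'a^'a \<Rightarrow> complex^'a^'a" where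
  "map_Delta_mhalf d p e X = spectral_powr d p e (- 1 / 2) ** X ** spectral_powr d p e (1 / 2)"

definition map_Q ::
    "nat \<Rightarrow> (nat \<Rightarrow> real) \<Rightarrow> (nat \<Rightarrow> complex^'a) \<Rightarrow> (complex^'a \<Rightarrow> complex^'a) \<Rightarrow>
     complex^'a^'a \<Rightarrow> complex^'a^'a" where
  "map_Q d p e \<theta> = map_Theta \<theta> \<circ> map_J \<circ> map_Delta_mhalf d p e"

definition op_f ::
    "complex^('a::finite \<times> 'e::finite)^('a \<times> 'e) \<Rightarrow> complex^'e \<Rightarrow> complex^'e \<Rightarrow> complex^'a^'a" where
  "op_f U \<xi> k = bra_E k ** U ** ket_E \<xi>"

definition op_g ::
    "complex^('b::finite \<times> 'e::finite)^('b \<times> 'e) \<Rightarrow> complex^'e \<Rightarrow> complex^'e \<Rightarrow> complex^'b^'b" where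
  "op_g V \<xi> k = bra_E k ** adj V ** ket_E \<xi>"

definition special_reversal ::
    "complex^('a::finite \<times> 'e::finite)^('a \<times> 'e) \<Rightarrow>
     complex^('b::finite \<times> 'e)^('b \<times> 'e) \<Rightarrow>
     complex^('a \<times> 'b) \<Rightarrow> complex^'e \<Rightarrow> complex^'e \<Rightarrow> bool" where
  "special_reversal U V \<Psi> \<xi> \<xi>' \<longleftrightarrow>
     (lift_BE V ** lift_AE U) *v tensor_AB_E \<Psi> \<xi> = tensor_AB_E \<Psi> \<xi>'"

end

theory Submission
  imports Defs
begin

text \<open>
  Multiplying the reversal condition by \<open>V\<^sup>\<dagger>\<close> and contracting the environment with \<open>\<langle>\<xi>|\<close> turns it
  into \<open>(f\<^sub>\<xi> \<otimes> I) |\<psi>\<rangle> = (I \<otimes> g\<^sub>\<xi>) |\<psi>\<rangle>\<close>; the completeness relation shows that these equations for one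
  overcomplete system are equivalent to the condition itself. Write \<open>\<theta>\<close> as a matrix \<open>T\<close>
  composed with entrywise conjugation, and read \<open>|\<psi>\<rangle>\<close> as the matrix \<open>P = \<sigma>\<^sup>1\<^sup>/\<^sup>2 (W T)\<^sup>T\<close>. The equation
  becomes \<open>f P = P g\<^sup>T\<close>, and since \<open>P\<close> is invertible it can be solved for \<open>g\<close>, which gives \<open>\<W>\<Q> f\<close>.
\<close>

section \<open>Adjoints and unitary matrices\<close>

lemma adj_adj [simp]: "adj (adj M) = M"
  by (simp add: adj_def vec_eq_iff)

lemma adj_matrix_mul: "adj (M ** N) = adj N ** adj M"
  by (simp add: adj_def matrix_matrix_mult_def vec_eq_iff mult.commute)

lemma unitary_mult:
  assumes "unitary M" "unitary N"
  shows "unitary (M ** N)"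
proof -
  have "adj N ** adj M ** (M ** N) = adj N ** (adj M ** M) ** N"
    by (simp only: matrix_mul_assoc)
  moreover have "M ** N ** (adj N ** adj M) = M ** (N ** adj N) ** adj M"
    by (simp only: matrix_mul_assoc)
  ultimately show ?thesis
    using assms by (simp add: unitary_def adj_matrix_mul)
qed

subsection \<open>Conjugations\<close>

definition cnj_vec :: "complex^'n \<Rightarrow> complex^'n" where
  "cnj_vec x = (\<chi> i. cnj (x $ i))"

lemma cnj_vec_cnj_vec [simp]: "cnj_vec (cnj_vec x) = x"
  by (simp add: cnj_vec_def vec_eq_iff)

text \<open>\<open>transpose (adj M)\<close> is the entrywise conjugate of \<open>M\<close>; it is
  written in this form throughout.\<close>

lemma cnj_vec_mult: "cnj_vec (M *v x) = transpose (adj M) *v cnj_vec x"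
  by (simp add: cnj_vec_def matrix_vector_mult_def adj_def transpose_def vec_eq_iff)

lemma cinner_axis_axis: "cinner (axis i 1) (axis j 1) = (if i = j then 1 else 0)"
  by (auto simp: cinner_def axis_def if_distrib[of cnj] if_distrib[of "\<lambda>x. x * _"] cong: if_cong)

text \<open>The Gram matrix of the columns of \<open>M\<close>: this turns preservation of inner
  products into unitarity.\<close>

lemma cinner_mult_axis:
  fixes M :: "complex^'n^'m"
  shows "cinner (M *v axis i 1) (M *v axis j 1) = (adj M ** M) $ i $ j"
proof -
  have "(M *v axis l 1) $ m = M $ m $ l" for l m
    by (simp add: matrix_vector_mult_def axis_def if_distrib[of "\<lambda>x. _ * x"] cong: if_cong)
  then show ?thesis
    by (simp add: cinner_def adj_def matrix_matrix_mult_def)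
qed

text \<open>Precomposing with \<open>cnj_vec\<close> makes the antilinear \<theta> linear, so a
  matrix \<open>T\<close> represents it. The last property obtained says that \<open>T\<close> is
  symmetric; it reflects that \<theta> is an involution.\<close>

lemma conjugation_matrix:
  fixes \<theta> :: "complex^'n \<Rightarrow> complex^'n"
  assumes "conjugation \<theta>"
  obtains T where "\<And>\<phi>. \<theta> \<phi> = T *v cnj_vec \<phi>" "unitary T" "transpose (adj T) = adj T"
proof -
  define T where "T = matrix (\<lambda>\<phi>. \<theta> (cnj_vec \<phi>))"
  have add: "\<theta> (\<phi> + \<psi>) = \<theta> \<phi> + \<theta> \<psi>"
    and scale: "\<theta> (c *s \<phi>) = cnj c *s \<theta> \<phi>"
    and inner: "cinner (\<theta> \<phi>) (\<theta> \<psi>) = cinner \<psi> \<phi>"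
    and invol: "\<theta> (\<theta> \<phi>) = \<phi>" for \<phi> \<psi> c
    using assms unfolding conjugation_def by blast+
  have "Vector_Spaces.linear (*s) (*s) (\<lambda>\<phi>. \<theta> (cnj_vec \<phi>))"
  proof
    fix x y :: "complex^'n" and c :: complex
    have "cnj_vec (x + y) = cnj_vec x + cnj_vec y" "cnj_vec (c *s x) = cnj c *s cnj_vec x"
      by (simp_all add: cnj_vec_def vec_eq_iff)
    then show "\<theta> (cnj_vec (x + y)) = \<theta> (cnj_vec x) + \<theta> (cnj_vec y)"
      and "\<theta> (cnj_vec (c *s x)) = c *s \<theta> (cnj_vec x)"
      by (simp_all add: add scale)
  qed
  then have T': "T *v \<phi> = \<theta> (cnj_vec \<phi>)" for \<phi>
    unfolding T_def by (rule matrix_works)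
  then have T: "\<theta> \<phi> = T *v cnj_vec \<phi>" for \<phi>
    by simp
  \<comment> \<open>The standard basis is real, so the columns of \<open>T\<close> are images of
    basis vectors under \<theta> itself.\<close>
  have "cnj_vec (axis i 1) = axis i 1" for i :: 'n
    by (auto simp: cnj_vec_def axis_def vec_eq_iff)
  then have "(adj T ** T) $ i $ j = mat 1 $ i $ j" for i j
    by (subst cinner_mult_axis [symmetric]) (auto simp: T' inner cinner_axis_axis mat_def)
  then have TT: "adj T ** T = mat 1"
    by (simp add: vec_eq_iff)
  then have "unitary T"
    by (simp add: unitary_def matrix_left_right_inverse)
  have "(T ** transpose (adj T)) *v \<phi> = \<phi>" for \<phi>
    using invol[of \<phi>] by (simp add: T cnj_vec_mult matrix_vector_mul_assoc del: transpose_matrix_vector)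
  then have inv: "T ** transpose (adj T) = mat 1"
    by (simp add: matrix_eq)
  \<comment> \<open>One matrix is a right inverse of \<open>T\<close>, the other a left inverse, so
    they coincide.\<close>
  have "transpose (adj T) = adj T ** T ** transpose (adj T)"
    by (simp add: TT)
  also have "\<dots> = adj T"
    by (simp add: inv flip: matrix_mul_assoc)
  finally show thesis
    using that T \<open>unitary T\<close> by blast
qed

text \<open>Moving the inner conjugation past \<open>adj X\<close> conjugates its entries, which
  leaves the transpose of \<open>X\<close>; likewise \<open>T\<close> becomes its entrywise
  conjugate, which is \<open>adj T\<close> by symmetry.\<close>

lemma map_Theta_map_J:
  assumes T: "\<And>\<phi>. \<theta> \<phi> = T *v cnj_vec \<phi>" and sym: "transpose (adj T) = adj T"
  shows "map_Theta \<theta> (map_J X) = T ** transpose X ** adj T"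
proof -
  have "\<theta> (adj X *v \<theta> \<phi>) = (T ** transpose X ** adj T) *v \<phi>" for \<phi>
    by (simp add: T cnj_vec_mult matrix_vector_mul_assoc adj_matrix_mul matrix_transpose_mul sym
        matrix_mul_assoc)
  then show ?thesis
    by (simp add: map_Theta_def map_J_def matrix_of_matrix_vector_mul)
qed

subsection \<open>Powers of a spectrally decomposed operator\<close>

lemma ketbra_mult_vec: "ketbra x y *v z = cinner y z *s x"
  by (simp add: ketbra_def matrix_vector_mult_def cinner_def vec_eq_iff sum_distrib_left
      sum_distrib_right mult_ac)

lemma sum_matrix_vector_mult: "(\<Sum>i\<in>I. M i) *v x = (\<Sum>i\<in>I. M i *v (x :: complex^'n))"
  by (induction I rule: infinite_finite_induct) (simp_all add: matrix_vector_mult_add_rdistrib)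

text \<open>The sum of projections fixes each basis vector, hence by linearity the whole
  span.\<close>

lemma orthonormal_basis_complete:
  assumes "orthonormal_basis d e"
  shows "(\<Sum>n<d. ketbra (e n) (e n)) = mat 1" (is "?S = _")
proof -
  have orth: "\<And>m n. m < d \<Longrightarrow> n < d \<Longrightarrow> cinner (e m) (e n) = (if m = n then 1 else 0)"
    and span: "vec.span (e ` {..<d}) = UNIV"
    using assms by (auto simp: orthonormal_basis_def)
  have "?S *v x = x" if "x \<in> vec.span (e ` {..<d})" for x
    using that
  proof (induction rule: vec.span_induct_alt)
    case base
    show ?case by simp
  next
    case (step c x y)
    then obtain m where m: "m < d" "x = e m" by auto
    have "?S *v x = (\<Sum>n<d. (if n = m then e n else 0))"
      unfolding sum_matrix_vector_mult
      by (rule sum.cong) (auto simp: m ketbra_mult_vec orth)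
    also have "\<dots> = x"
      using m by simp
    finally show ?case
      using step by (simp add: matrix_vector_right_distrib vector_scalar_commute)
  qed
  then show ?thesis
    by (simp add: matrix_eq span)
qed

lemma spectral_powr_nth:
  "spectral_powr d p e s $ i $ j = (\<Sum>n<d. of_real (p n powr s) * (e n $ i * cnj (e n $ j)))"
  by (simp add: spectral_powr_def ketbra_def sum_component scaleR_conv_of_real[where 'a=complex])

lemma spectral_powr_mult_vec:
  "spectral_powr d p e s *v x = (\<Sum>n<d. (of_real (p n powr s) * cinner (e n) x) *s e n)"
  unfolding spectral_powr_def sum_matrix_vector_mult
  by (rule sum.cong)
    (simp_all add: ketbra_def cinner_def matrix_vector_mult_def vec_eq_iff sum_distrib_left
      sum_distrib_right scaleR_conv_of_real[where 'a=complex] mult_ac)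

lemma spectral_powr_mult_basis:
  assumes "orthonormal_basis d e" "m < d"
  shows "spectral_powr d p e s *v e m = of_real (p m powr s) *s e m"
proof -
  have "spectral_powr d p e s *v e m =
      (\<Sum>n<d. if n = m then of_real (p m powr s) *s e m else 0)"
    unfolding spectral_powr_mult_vec using assms
    by (intro sum.cong) (auto simp: orthonormal_basis_def)
  then show ?thesis
    using assms by simp
qed

lemma spectral_powr_minus_cancel:
  assumes "orthonormal_basis d e" and "\<And>n. n < d \<Longrightarrow> p n > 0"
  shows "spectral_powr d p e s ** spectral_powr d p e (- s) = mat 1"
proof -
  have "(spectral_powr d p e s ** spectral_powr d p e (- s)) *v x = x" for x
  proof -
    \<comment> \<open>Positivity matters here, since \<open>0 powr s\<close> is
      \<open>0\<close>.\<close>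
    have "p n powr s * p n powr (- s) = 1" if "n < d" for n
      using assms(2)[OF that] by (simp flip: powr_add)
    then have "complex_of_real (p n powr s) * of_real (p n powr (- s)) = 1" if "n < d" for n
      using that by (metis of_real_1 of_real_mult)
    then have eq: "of_real (p n powr (- s)) * z * of_real (p n powr s) = (z::complex)"
      if "n < d" for n z
      using that by (metis mult.assoc mult.commute mult_1)
    have "(spectral_powr d p e s ** spectral_powr d p e (- s)) *v x =
        (\<Sum>n<d. (of_real (p n powr (- s)) * cinner (e n) x) *s (of_real (p n powr s) *s e n))"
      by (simp add: spectral_powr_mult_vec[of _ _ _ "- s"] spectral_powr_mult_basis[OF assms(1)]
          vec.linear_sum[OF matrix_vector_mul_linear_gen] vector_scalar_commute
          flip: matrix_vector_mul_assoc)
    also have "\<dots> = (\<Sum>n<d. ketbra (e n) (e n) *v x)"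
      by (rule sum.cong) (simp_all add: ketbra_mult_vec eq)
    also have "\<dots> = x"
      by (simp add: orthonormal_basis_complete[OF assms(1)] flip: sum_matrix_vector_mult)
    finally show ?thesis .
  qed
  then show ?thesis
    by (simp add: matrix_eq)
qed

subsection \<open>Contraction of the environment\<close>

lemma sum_UNIV_prod: "(\<Sum>z\<in>UNIV. f z) = (\<Sum>x\<in>UNIV. \<Sum>y\<in>UNIV. f (x, y))"
  by (simp add: sum.cartesian_product flip: UNIV_Times_UNIV)

lemma sum_if_const: "(\<Sum>y\<in>A. if P then f y else 0) = (if P then \<Sum>y\<in>A. f y else 0)"
  by simp

lemma tensor_op_mult: "tensor_op M N ** tensor_op M' N' = tensor_op (M ** M') (N ** N')"
  by (simp add: tensor_op_def matrix_matrix_mult_def vec_eq_iff sum_UNIV_prod sum_product mult_ac)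

lemma tensor_op_mat_1: "tensor_op (mat 1) (mat 1) = mat 1"
  by (auto simp: tensor_op_def mat_def vec_eq_iff prod_eq_iff)

text \<open>Inverting \<open>V\<close> leaves one operator on each side, and is the source of the
  adjoint in \<open>op_g\<close>.\<close>

lemma special_reversal_iff:
  fixes U :: "complex^('a::finite \<times> 'e::finite)^('a \<times> 'e)"
    and V :: "complex^('b::finite \<times> 'e)^('b \<times> 'e)"
  assumes "unitary V"
  shows "special_reversal U V \<Psi> \<xi> \<xi>' \<longleftrightarrow>
    lift_AE U *v tensor_AB_E \<Psi> \<xi> = lift_BE (adj V) *v tensor_AB_E \<Psi> \<xi>'"
proof -
  let ?V = "lift_BE V :: complex^('a \<times> 'b \<times> 'e)^('a \<times> 'b \<times> 'e)"
  have "lift_BE (adj V) ** ?V = mat 1" "?V ** lift_BE (adj V) = mat 1"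
    using assms by (simp_all add: lift_BE_def tensor_op_mult tensor_op_mat_1 unitary_def)
  then have "?V *v x = y \<longleftrightarrow> x = lift_BE (adj V) *v y" for x y
    by (auto simp: matrix_vector_mul_assoc)
  then show ?thesis
    by (simp add: special_reversal_def flip: matrix_vector_mul_assoc)
qed

text \<open>The partial inner product with \<xi> on \<open>E\<close>. The remaining vector on
  \<open>A\<close> and \<open>B\<close> is stored as a matrix, with rows for \<open>A\<close> and
  columns for \<open>B\<close>.\<close>

definition contract_E ::
    "complex^'e \<Rightarrow> complex^('a::finite \<times> 'b::finite \<times> 'e::finite) \<Rightarrow> complex^'b^'a" where
  "contract_E \<xi> \<Phi> = (\<chi> a b. \<Sum>i\<in>UNIV. cnj (\<xi> $ i) * \<Phi> $ (a, b, i))"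

lemma overcomplete_contract_E_cancel:
  assumes "overcomplete D k" and eq: "\<And>j. j < D \<Longrightarrow> contract_E (k j) \<Phi> = contract_E (k j) \<Phi>'"
  shows "\<Phi> = \<Phi>'"
proof -
  have compl: "(\<Sum>j<D. k j $ i * cnj (k j $ i')) = (if i = i' then 1 else 0)" for i i'
    using arg_cong[OF assms(1)[unfolded overcomplete_def], of "\<lambda>M. M $ i $ i'"]
    by (simp add: sum_component ketbra_def mat_def)
  \<comment> \<open>Inserting the completeness relation on \<open>E\<close> reconstructs a vector
    from its contractions.\<close>
  have expand: "\<Phi> $ (a, b, i) = (\<Sum>j<D. k j $ i * contract_E (k j) \<Phi> $ a $ b)" for \<Phi> a b i
  proof -
    have "(\<Sum>j<D. k j $ i * contract_E (k j) \<Phi> $ a $ b) =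
        (\<Sum>i'\<in>UNIV. (\<Sum>j<D. k j $ i * cnj (k j $ i')) * \<Phi> $ (a, b, i'))"
      by (simp add: contract_E_def sum_distrib_left sum_distrib_right mult_ac)
        (rule sum.swap)
    also have "\<dots> = \<Phi> $ (a, b, i)"
      by (simp add: compl if_distrib[of "\<lambda>x. x * _"] cong: if_cong)
    finally show ?thesis by simp
  qed
  have "\<Phi> $ (a, b, i) = \<Phi>' $ (a, b, i)" for a b i
    by (simp add: expand[of \<Phi>] expand[of \<Phi>'] eq)
  then show ?thesis
    by (simp add: vec_eq_iff)
qed

lemma ket_E_nth: "ket_E \<xi> $ (x, i) $ x' = (if x = x' then \<xi> $ i else 0)"
  by (simp add: ket_E_def matrix_def tensor_vec_def axis_def)

lemma bra_op_ket_nth: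
  "(bra_E \<eta> ** M ** ket_E \<xi>) $ x $ x' =
    (\<Sum>i\<in>UNIV. \<Sum>i'\<in>UNIV. cnj (\<eta> $ i) * M $ (x, i) $ (x', i') * \<xi> $ i')"
proof -
  have "(bra_E \<eta> ** M ** ket_E \<xi>) $ x $ x' =
    (\<Sum>i'\<in>UNIV. \<Sum>i\<in>UNIV. cnj (\<eta> $ i) * M $ (x, i) $ (x', i') * \<xi> $ i')"
    by (simp add: matrix_matrix_mult_def sum_UNIV_prod bra_E_def adj_def ket_E_nth
        if_distrib[of cnj] if_distrib[of "\<lambda>x. x * _"] if_distrib[of "\<lambda>x. _ * x"]
        sum_if_const sum_distrib_right cong: if_cong)
  also have "\<dots> = (\<Sum>i\<in>UNIV. \<Sum>i'\<in>UNIV. cnj (\<eta> $ i) * M $ (x, i) $ (x', i') * \<xi> $ i')"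
    by (rule sum.swap)
  finally show ?thesis .
qed

definition vec_matrix :: "complex^('a::finite \<times> 'b::finite) \<Rightarrow> complex^'b^'a" where
  "vec_matrix \<Psi> = (\<chi> a b. \<Psi> $ (a, b))"

lemma vec_matrix_nth: "vec_matrix \<Psi> $ a $ b = \<Psi> $ (a, b)"
  by (simp add: vec_matrix_def)

text \<open>The bra acts on \<open>E\<close> alone and combines with \<open>U\<close> and the ket to
  form \<open>op_f\<close>, an operator on \<open>A\<close>, which acts on the row index.\<close>

lemma contract_E_lift_AE:
  "contract_E \<eta> (lift_AE U *v tensor_AB_E \<Psi> \<xi>) = op_f U \<xi> \<eta> ** vec_matrix \<Psi>"
proof -
  have "(lift_AE U *v tensor_AB_E \<Psi> \<xi>) $ (a, b, i) =
      (\<Sum>a'\<in>UNIV. \<Sum>i'\<in>UNIV. U $ (a, i) $ (a', i') * (\<Psi> $ (a', b) * \<xi> $ i'))" for a b i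
    unfolding matrix_vector_mult_def lift_AE_def tensor_AB_E_def
    by (simp add: sum_UNIV_prod if_distrib[of "\<lambda>x. x * _"] sum_if_const cong: if_cong)
  then have "contract_E \<eta> (lift_AE U *v tensor_AB_E \<Psi> \<xi>) $ a $ b =
      (op_f U \<xi> \<eta> ** vec_matrix \<Psi>) $ a $ b" for a b
    by (simp add: contract_E_def op_f_def matrix_matrix_mult_def[of "bra_E \<eta> ** U ** ket_E \<xi>"]
        bra_op_ket_nth vec_matrix_nth sum_distrib_left sum_distrib_right mult_ac) (rule sum.swap)
  then show ?thesis
    by (simp add: vec_eq_iff)
qed

text \<open>Here the operator acts on \<open>B\<close>, the column index, so it multiplies from the
  right and is transposed.\<close>

lemma contract_E_lift_BE:
  "contract_E \<eta> (lift_BE (adj V) *v tensor_AB_E \<Psi> \<xi>) =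
    vec_matrix \<Psi> ** transpose (op_g V \<xi> \<eta>)"
proof -
  have "(lift_BE M *v tensor_AB_E \<Psi> \<xi>) $ (a, b, i) =
      (\<Sum>b'\<in>UNIV. \<Sum>i'\<in>UNIV. M $ (b, i) $ (b', i') * (\<Psi> $ (a, b') * \<xi> $ i'))" for M a b i
    unfolding matrix_vector_mult_def lift_BE_def tensor_AB_E_def tensor_op_def mat_def
    by (simp add: sum_UNIV_prod if_distrib[of "\<lambda>x. x * _"] sum_if_const cong: if_cong)
  then have "contract_E \<eta> (lift_BE (adj V) *v tensor_AB_E \<Psi> \<xi>) $ a $ b =
      (vec_matrix \<Psi> ** transpose (op_g V \<xi> \<eta>)) $ a $ b" for a b
    by (simp add: contract_E_def op_g_def matrix_matrix_mult_def[of "vec_matrix \<Psi>"]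
        bra_op_ket_nth vec_matrix_nth transpose_def sum_distrib_left sum_distrib_right mult_ac)
      (rule sum.swap)
  then show ?thesis
    by (simp add: vec_eq_iff)
qed

lemma special_reversal_iff_overcomplete:
  assumes "unitary V" "overcomplete D k"
  shows "special_reversal U V \<Psi> \<xi> \<xi>' \<longleftrightarrow>
    (\<forall>j<D. op_f U \<xi> (k j) ** vec_matrix \<Psi> = vec_matrix \<Psi> ** transpose (op_g V \<xi>' (k j)))"
  unfolding special_reversal_iff[OF assms(1)]
    contract_E_lift_AE [symmetric] contract_E_lift_BE [symmetric]
  using overcomplete_contract_E_cancel[OF assms(2)] by auto

subsection \<open>The purification as an invertible matrix\<close>

text \<open>The conjugated entries of \<open>e n\<close> that \<theta> produces in the second factor
  supply the bra of each spectral projection, so the sum over \<open>n\<close> assembles the square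
  root of \<sigma>.\<close>

lemma vec_matrix_psi_AB:
  assumes T: "\<And>\<phi>. \<theta> \<phi> = T *v cnj_vec \<phi>" and pos: "\<And>n. n < d \<Longrightarrow> p n > 0"
  shows "vec_matrix (psi_AB d p e \<theta> W) = spectral_powr d p e (1 / 2) ** transpose (W ** T)"
proof -
  have "(W *v \<theta> x) $ b = (\<Sum>a'\<in>UNIV. (W ** T) $ b $ a' * cnj (x $ a'))" for x b
    by (simp only: T matrix_vector_mul_assoc) (simp add: matrix_vector_mult_def cnj_vec_def)
  then have "psi_AB d p e \<theta> W $ (a, b) =
      (\<Sum>n<d. of_real (p n powr (1 / 2)) *
        (e n $ a * (\<Sum>a'\<in>UNIV. (W ** T) $ b $ a' * cnj (e n $ a'))))" for a b
    by (simp add: psi_AB_def sum_component tensor_vec_def scaleR_conv_of_real[where 'a=complex]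
        powr_half_sqrt less_imp_le[OF pos])
  then have "vec_matrix (psi_AB d p e \<theta> W) $ a $ b =
      (spectral_powr d p e (1 / 2) ** transpose (W ** T)) $ a $ b" for a b
    by (simp add: vec_matrix_nth matrix_matrix_mult_def[of "spectral_powr _ _ _ _"]
        transpose_def spectral_powr_nth sum_distrib_left sum_distrib_right mult_ac) (rule sum.swap)
  then show ?thesis
    by (simp add: vec_eq_iff)
qed

text \<open>Meant for \<open>R\<close> the square root of \<sigma> and \<open>K = W ** T\<close>.
  Multiplying by the inverse of \<open>R ** transpose K\<close> isolates \<open>transpose G\<close>;
  transposing once more gives \<open>G\<close>.\<close>

lemma intertwining_iff:
  assumes "unitary K" and R: "R ** R' = mat 1" "R' ** R = mat 1"
  shows "F ** (R ** transpose K) = R ** transpose K ** transpose G \<longleftrightarrow>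
    G = K ** transpose (R' ** F ** R) ** adj K"
    (is "?L = ?M \<longleftrightarrow> _")
proof -
  let ?P = "R ** transpose K" and ?P' = "transpose (adj K) ** R'"
  have K: "transpose K ** transpose (adj K) = mat 1" "transpose (adj K) ** transpose K = mat 1"
    using assms(1) by (simp_all add: unitary_def transpose_mat flip: matrix_transpose_mul)
  have "?P ** ?P' = R ** (transpose K ** transpose (adj K)) ** R'"
    and "?P' ** ?P = transpose (adj K) ** (R' ** R) ** transpose K"
    by (simp_all only: matrix_mul_assoc)
  then have P: "?P ** ?P' = mat 1" "?P' ** ?P = mat 1"
    by (simp_all add: K R)
  have "?L = ?M \<longleftrightarrow> transpose G = ?P' ** ?L"
  proof
    assume "?L = ?M"
    then have "?P' ** ?L = ?P' ** ?P ** transpose G"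
      by (simp only: matrix_mul_assoc)
    then show "transpose G = ?P' ** ?L"
      by (simp only: P matrix_mul_lid)
  next
    assume "transpose G = ?P' ** ?L"
    then have "?M = ?P ** ?P' ** ?L"
      by (simp only: matrix_mul_assoc)
    then show "?L = ?M"
      by (simp only: P matrix_mul_lid)
  qed
  also have "\<dots> \<longleftrightarrow> G = transpose (?P' ** ?L)"
    by (rule iffI) (drule arg_cong[of _ _ transpose], simp only: transpose_transpose)+
  also have "transpose (?P' ** ?L) = K ** transpose (R' ** F ** R) ** adj K"
    by (simp add: matrix_transpose_mul matrix_mul_assoc)
  finally show ?thesis .
qed

theorem theorem4p1:
  fixes d :: nat
    and U :: "complex^('a::finite \<times> 'e::finite)^('a \<times> 'e)"
    and V :: "complex^('b::finite \<times> 'e)^('b \<times> 'e)"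
    and chi chi' :: "complex^'e"
    and \<sigma> :: "complex^'a^'a"
    and p :: "nat \<Rightarrow> real"
    and e :: "nat \<Rightarrow> complex^'a"
    and \<theta> :: "complex^'a \<Rightarrow> complex^'a"
    and W :: "complex^'a^'b"
    and D :: nat
    and k :: "nat \<Rightarrow> complex^'e"
  assumes "CARD('a) = d" and "CARD('b) = d"
    and "unitary U" and "unitary V"
    and "norm chi = 1" and "norm chi' = 1"
    and "density_operator \<sigma>" and "channel_F U chi \<sigma> = \<sigma>"
    and "orthonormal_basis d e" and "\<And>n. n < d \<Longrightarrow> p n > 0"
    and "\<sigma> = (\<Sum>n<d. p n *\<^sub>R ketbra (e n) (e n))"
    and "conjugation \<theta>" and "unitary W"
    and "overcomplete D k"
  shows "(special_reversal U V (psi_AB d p e \<theta> W) chi chi' \<longleftrightarrow>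
           (\<forall>j<D. op_g V chi' (k j) = map_W W (map_Q d p e \<theta> (op_f U chi (k j))))) \<and>
         ((\<forall>j<D. op_g V chi' (k j) = map_W W (map_Q d p e \<theta> (op_f U chi (k j)))) \<longrightarrow>
           (\<forall>D' k'. overcomplete D' k' \<longrightarrow>
             (\<forall>j<D'. op_g V chi' (k' j) = map_W W (map_Q d p e \<theta> (op_f U chi (k' j))))))"
proof -
  obtain T where T: "\<And>\<phi>. \<theta> \<phi> = T *v cnj_vec \<phi>" "unitary T" "transpose (adj T) = adj T"
    using conjugation_matrix[OF \<open>conjugation \<theta>\<close>] by blast
  let ?P = "vec_matrix (psi_AB d p e \<theta> W)"
  let ?R = "spectral_powr d p e"
  have inv: "?R (1 / 2) ** ?R (- 1 / 2) = mat 1" "?R (- 1 / 2) ** ?R (1 / 2) = mat 1"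
    using spectral_powr_minus_cancel[OF assms(9,10), where s = "1 / 2"]
      spectral_powr_minus_cancel[OF assms(9,10), where s = "- 1 / 2"]
    by simp_all
  \<comment> \<open>In matrix form the composite map is exactly the solution for \<open>G\<close> in
    \<open>intertwining_iff\<close>.\<close>
  have Q: "map_W W (map_Q d p e \<theta> F) =
      W ** T ** transpose (?R (- 1 / 2) ** F ** ?R (1 / 2)) ** adj (W ** T)" for F
    by (simp only: map_W_def map_Q_def o_def map_Theta_map_J[OF T(1,3)] map_Delta_mhalf_def
        adj_matrix_mul matrix_mul_assoc)
  have P: "?P = ?R (1 / 2) ** transpose (W ** T)"
    using T(1) \<open>\<And>n. n < d \<Longrightarrow> p n > 0\<close> by (rule vec_matrix_psi_AB)
  have "F ** ?P = ?P ** transpose G \<longleftrightarrow> G = map_W W (map_Q d p e \<theta> F)" for F G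
    unfolding P Q
    by (rule intertwining_iff[OF unitary_mult[OF \<open>unitary W\<close> T(2)] inv])
  \<comment> \<open>The left side does not mention the overcomplete system, so this one equivalence,
    stated for every system, yields both claims.\<close>
  then have "special_reversal U V (psi_AB d p e \<theta> W) chi chi' \<longleftrightarrow>
      (\<forall>j<D'. op_g V chi' (k' j) = map_W W (map_Q d p e \<theta> (op_f U chi (k' j))))"
    if "overcomplete D' k'" for D' k'
    unfolding special_reversal_iff_overcomplete[OF \<open>unitary V\<close> that] by simp
  then show ?thesis
    using \<open>overcomplete D k\<close> by blast
qed

end
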